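(* For a set-system hypergraph $H$, let $\mathrm{Del}(H)$ be the multigraph with $V(\mathrm{Del}(H))=V(H)$, $E(\mathrm{Del}(H))=\{e\in E(H):1\le|\epsilon_H(e)|\le 2\}$ and $\epsilon_{\mathrm{Del}(H)}=\epsilon_H$ restricted to this set, and let $j_H:\mathrm{Del}(H)\to H$ be the inclusion morphism. If $G$ is a multigraph and $\phi:G\to H$ is a morphism in $\mathfrak{H}$, then there is a unique morphism $\hat\phi:G\to\mathrm{Del}(H)$ in $\mathfrak{M}$ with $j_H\circ\hat\phi=\phi$.
   Context: A set-system hypergraph $G$ consists of sets $V(G)$, $E(G)$ and a function $\epsilon_G:E(G)\to\mathcal{P}(V(G))$. A morphism $\phi:G\to H$ is a pair of functions $V(\phi)$, $E(\phi)$ with $\epsilon_H\circ E(\phi)=\mathcal{P}V(\phi)\circ\epsilon_G$, where $\mathcal{P}f(A)$ is the image of $A$. This forms the category $\mathfrak{H}$. A multigraph is a set-system hypergraph with $1\le|\epsilon_G(e)|\le 2$ for all edges $e$; $\mathfrak{M}$ is the full subcategory of $\mathfrak{H}$ on multigraphs. *)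

theory Defs
  imports Main "HOL-Library.FuncSet"
begin

text \<open>All functions between carriers are extensional (undefined outside their domain),
  so that equality of morphisms is HOL equality.\<close>

record ('v, 'e) hypergraph =
  verts :: "'v set"
  edges :: "'e set"
  eps :: "'e \<Rightarrow> 'v set"

definition set_system_hypergraph :: "('v, 'e) hypergraph \<Rightarrow> bool" where
  "set_system_hypergraph G \<longleftrightarrow> eps G \<in> edges G \<rightarrow>\<^sub>E Pow (verts G)"

text \<open>An infinite set has \<open>card\<close> 0, hence the lower bound also excludes infinite edges.\<close>

definition multigraph :: "('v, 'e) hypergraph \<Rightarrow> bool" where
  "multigraph G \<longleftrightarrow> set_system_hypergraph G \<and>
     (\<forall>e\<in>edges G. 1 \<le> card (eps G e) \<and> card (eps G e) \<le> 2)"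

record ('v, 'e, 'w, 'f) hyp_map =
  vmap :: "'v \<Rightarrow> 'w"
  emap :: "'e \<Rightarrow> 'f"

definition hyp_hom ::
  "('v, 'e) hypergraph \<Rightarrow> ('w, 'f) hypergraph \<Rightarrow> ('v, 'e, 'w, 'f) hyp_map set" where
  "hyp_hom G H = {\<phi>. set_system_hypergraph G \<and> set_system_hypergraph H \<and>
     vmap \<phi> \<in> verts G \<rightarrow>\<^sub>E verts H \<and> emap \<phi> \<in> edges G \<rightarrow>\<^sub>E edges H \<and>
     (\<forall>e\<in>edges G. eps H (emap \<phi> e) = vmap \<phi> ` eps G e)}"

definition multigraph_hom ::
  "('v, 'e) hypergraph \<Rightarrow> ('w, 'f) hypergraph \<Rightarrow> ('v, 'e, 'w, 'f) hyp_map set" where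
  "multigraph_hom G H = {\<phi> \<in> hyp_hom G H. multigraph G \<and> multigraph H}"

text \<open>The domain \<open>G\<close> of the first-applied map is an explicit argument, as in \<^const>\<open>compose\<close>.\<close>

definition hyp_comp ::
  "('u, 'd) hypergraph \<Rightarrow> ('v, 'e, 'w, 'f) hyp_map \<Rightarrow> ('u, 'd, 'v, 'e) hyp_map
     \<Rightarrow> ('u, 'd, 'w, 'f) hyp_map" where
  "hyp_comp G \<psi> \<phi> = \<lparr>vmap = compose (verts G) (vmap \<psi>) (vmap \<phi>),
                     emap = compose (edges G) (emap \<psi>) (emap \<phi>)\<rparr>"

definition Del :: "('v, 'e) hypergraph \<Rightarrow> ('v, 'e) hypergraph" where
  "Del H = (let E = {e \<in> edges H. 1 \<le> card (eps H e) \<and> card (eps H e) \<le> 2}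
            in \<lparr>verts = verts H, edges = E, eps = restrict (eps H) E\<rparr>)"

definition Del_incl :: "('v, 'e) hypergraph \<Rightarrow> ('v, 'e, 'v, 'e) hyp_map" where
  "Del_incl H = \<lparr>vmap = \<lambda>v\<in>verts (Del H). v, emap = \<lambda>e\<in>edges (Del H). e\<rparr>"

end

(* The image of a set with one or two elements has one or two elements, so a morphism
   from a multigraph to H only hits edges of Del H. As composition with the inclusion
   leaves a morphism into Del H unchanged, the factorization of a morphism is the
   morphism itself. *)

theory Submission imports Defs begin

lemma verts_Del [simp]: "verts (Del H) = verts H"
  and edges_Del: "edges (Del H) = {e \<in> edges H. 1 \<le> card (eps H e) \<and> card (eps H e) \<le> 2}"
  and eps_Del: "eps (Del H) = restrict (eps H) (edges (Del H))"
  by (simp_all add: Del_def Let_def)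

lemma multigraph_Del:
  assumes "set_system_hypergraph H"
  shows "multigraph (Del H)"
  using assms unfolding multigraph_def set_system_hypergraph_def
  by (auto simp: edges_Del eps_Del PiE_iff)

lemma Del_incl_in_hyp_hom:
  assumes "set_system_hypergraph H"
  shows "Del_incl H \<in> hyp_hom (Del H) H"
proof -
  \<comment> \<open>The identity \<open>\<lambda>v\<in>verts H. v\<close> is undefined off
    \<open>verts H\<close>, so it fixes an incidence set only once that set is known to lie inside
    \<open>verts H\<close>.\<close>
  have "eps H e \<subseteq> verts H" if "e \<in> edges H" for e
    using assms that by (auto simp: set_system_hypergraph_def PiE_iff)
  then have "(\<lambda>v\<in>verts H. v) ` eps H e = eps H e" if "e \<in> edges H" for e
    using that by (force simp: image_iff)
  then show ?thesis
    using assms multigraph_Del[OF assms]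
    by (auto simp: hyp_hom_def Del_incl_def multigraph_def eps_Del edges_Del PiE_iff)
qed

text \<open>Both components of the inclusion are extensional identities, so composing only restricts
  \<open>\<psi>\<close> to the carriers of \<open>G\<close>, outside of which it is already
  undefined.\<close>

lemma hyp_comp_Del_incl:
  assumes "\<psi> \<in> hyp_hom G (Del H)"
  shows "hyp_comp G (Del_incl H) \<psi> = \<psi>"
proof (rule hyp_map.equality)
  have v: "vmap \<psi> \<in> verts G \<rightarrow>\<^sub>E verts (Del H)" and e: "emap \<psi> \<in> edges G \<rightarrow>\<^sub>E edges (Del H)"
    using assms by (auto simp: hyp_hom_def)
  show "vmap (hyp_comp G (Del_incl H) \<psi>) = vmap \<psi>"
    using v by (simp add: hyp_comp_def Del_incl_def Id_compose PiE_iff Pi_iff del: verts_Del)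
  show "emap (hyp_comp G (Del_incl H) \<psi>) = emap \<psi>"
    using e by (simp add: hyp_comp_def Del_incl_def Id_compose PiE_iff Pi_iff)
qed simp

lemma hyp_hom_into_Del:
  assumes "multigraph G" and \<phi>: "\<phi> \<in> hyp_hom G H"
  shows "\<phi> \<in> multigraph_hom G (Del H)"
proof -
  have H: "set_system_hypergraph H"
    using \<phi> by (simp add: hyp_hom_def)
  have "emap \<phi> e \<in> edges (Del H)" if e: "e \<in> edges G" for e
  proof -
    have card: "1 \<le> card (eps G e)" "card (eps G e) \<le> 2"
      using assms(1) e by (auto simp: multigraph_def)
    \<comment> \<open>Empty and infinite sets both have \<open>card\<close> 0, so the lower bound
      rules out both.\<close>
    then have fin: "finite (eps G e)" and "eps G e \<noteq> {}"
      by (auto intro: card_ge_0_finite)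
    then have "1 \<le> card (vmap \<phi> ` eps G e)"
      by (simp add: Suc_le_eq card_gt_0_iff)
    moreover have "card (vmap \<phi> ` eps G e) \<le> 2"
      using card_image_le[OF fin] card(2) by (rule order_trans)
    ultimately show ?thesis
      using \<phi> e by (auto simp: hyp_hom_def edges_Del)
  qed
  \<comment> \<open>The incidence condition carries over because \<open>eps (Del H)\<close> agrees
    with \<open>eps H\<close> on the edges of \<open>Del H\<close>, where \<open>emap \<phi>\<close>
    takes its values.\<close>
  then show ?thesis
    using assms multigraph_Del[OF H]
    by (auto simp: multigraph_hom_def hyp_hom_def multigraph_def eps_Del PiE_iff)
qed

theorem mainTheorem8:
  fixes H :: "('v, 'e) hypergraph"
  assumes "set_system_hypergraph H"
  shows "multigraph (Del H) \<and> Del_incl H \<in> hyp_hom (Del H) H \<and>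
    (\<forall>(G :: ('w, 'f) hypergraph) \<phi>. multigraph G \<longrightarrow> \<phi> \<in> hyp_hom G H \<longrightarrow>
       (\<exists>!\<psi>. \<psi> \<in> multigraph_hom G (Del H) \<and> hyp_comp G (Del_incl H) \<psi> = \<phi>))"
proof (intro conjI allI impI)
  fix G :: "('w, 'f) hypergraph" and \<phi>
  assume "multigraph G" "\<phi> \<in> hyp_hom G H"
  then have "\<phi> \<in> multigraph_hom G (Del H)"
    by (rule hyp_hom_into_Del)
  \<comment> \<open>For every candidate the required equation thus reads
    \<open>\<psi> = \<phi>\<close>, which settles both existence and uniqueness.\<close>
  moreover have "hyp_comp G (Del_incl H) \<psi> = \<psi>" if "\<psi> \<in> multigraph_hom G (Del H)" for \<psi>
    using that by (auto simp: multigraph_hom_def intro: hyp_comp_Del_incl)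
  ultimately show "\<exists>!\<psi>. \<psi> \<in> multigraph_hom G (Del H) \<and> hyp_comp G (Del_incl H) \<psi> = \<phi>"
    by metis
qed (simp_all add: assms multigraph_Del Del_incl_in_hyp_hom)

end
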